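(* Let $p\in[0,1/2)$, $q=1-p$ (so $p<q$), let $\bar g=\{g_j\}_{j\in\mathbb N}$ satisfy $\sup_j|g_j|<\infty$, and let $\{X_j\}_{j\in\mathbb N}$ be an infinite system of competing Brownian particles with parameters $p,\bar g$, initial conditions $\bar x=\{x_j\}$ and driving Brownian motions $\{B_j\}$. For $i,M\in\mathbb N$ and $T\in(0,\infty)$ put $I^*_M(i,T)=\inf_{0\le s\le T}X_{i+M}(s)$. Then for every $i\in\mathbb N$ and $T\in(0,\infty)$, $$\liminf_{M\to\infty}\frac{I^*_M(i,T)}{\sqrt M}=\infty\quad\text{a.s.}$$ Furthermore, $\liminf_{M\to\infty}x_M/\sqrt M=\infty$ a.s.
   Context: Setting. $(\Omega,\mathcal F,\{\mathcal F_t\}_{t\ge0},\mathbb P)$ is a filtered probability space carrying independent standard one-dimensional ($\mathcal F_t$-adapted) Brownian motions $\{B_j\}_{j\in\mathbb N}$ such that $\{B_i(t+\cdot)-B_i(t),\,i\in\mathbb N\}$ is independent of $\mathcal F_t$ for all $t\ge0$, and $\bar x=\{x_j\}_{j\in\mathbb N}$ is a non-decreasing sequence of real $\mathcal F_0$-measurable random variables (initial conditions). An infinite system of competing Brownian particles (a solution) with parameters $p,\bar g$, initial conditions $\bar x$ and driving Brownian motions $\{B_j\}$ is a collection $\{X_j\}_{j\in\mathbb N}$ of continuous, real-valued, $\{\mathcal F_t\}$-adapted processes for which there are continuous, real-valued, $\{\mathcal F_t\}$-adapted processes $\{L_{(j,j+1)}\}_{j\ge0}$ (the associated local times) such that: (P1)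 for all $t\ge0$, $j\in\mathbb N$: $X_j(t)=x_j+g_jt+B_j(t)+pL_{(j-1,j)}(t)-qL_{(j,j+1)}(t)$; (P2) for all $t\ge0$ the sequence $\{X_j(t)\}_{j\in\mathbb N}$ is non-decreasing; (P3) $L_{(0,1)}\equiv0$, and for $j\ge1$, $L_{(j,j+1)}$ is non-decreasing with $L_{(j,j+1)}(0)=0$ and $\int_0^\infty(X_{j+1}(t)-X_j(t))\,dL_{(j,j+1)}(t)=0$. *)

theory Defs
  imports "HOL-Probability.Probability"
begin

text \<open>
  Time is the half-line \<open>t \<ge> 0\<close> inside \<open>real\<close>; nothing is assumed about processes or
  the filtration at negative times.  Particles are indexed by \<open>j \<ge> 1\<close>, and
  \<open>L j\<close> stands for the local time \<open>L\<^sub>(\<^sub>j\<^sub>,\<^sub>j\<^sub>+\<^sub>1\<^sub>)\<close>, so that \<open>L 0\<close> is the (vanishing)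
  local time below the lowest particle.  Path properties are required almost surely.
\<close>

definition adapted :: "(real \<Rightarrow> 'a measure) \<Rightarrow> (real \<Rightarrow> 'a \<Rightarrow> real) \<Rightarrow> bool" where
  "adapted F Y \<longleftrightarrow> (\<forall>t\<ge>0. Y t \<in> borel_measurable (F t))"

definition (in prob_space) standard_brownian_motion :: "(real \<Rightarrow> 'a \<Rightarrow> real) \<Rightarrow> bool" where
  "standard_brownian_motion W \<longleftrightarrow>
     (\<forall>t\<ge>0. random_variable borel (W t)) \<and>
     (AE \<omega> in M. W 0 \<omega> = 0) \<and>
     (AE \<omega> in M. continuous_on {0..} (\<lambda>t. W t \<omega>)) \<and>
     (\<forall>s t. 0 \<le> s \<and> s < t \<longrightarrow>
        distributed M lborel (\<lambda>\<omega>. W t \<omega> - W s \<omega>) (normal_density 0 (sqrt (t - s)))) \<and>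
     (\<forall>n (\<tau> :: nat \<Rightarrow> real). 0 \<le> \<tau> 0 \<and> mono_on {..n} \<tau> \<longrightarrow>
        indep_vars (\<lambda>_. borel) (\<lambda>k \<omega>. W (\<tau> (Suc k)) \<omega> - W (\<tau> k) \<omega>) {..<n})"

text \<open>The \<open>\<sigma>\<close>-algebra generated by all the processes \<open>B\<^sub>i(t + \<cdot>) - B\<^sub>i(t)\<close>, \<open>i \<ge> 1\<close>.\<close>

definition future_increments ::
    "'a measure \<Rightarrow> (nat \<Rightarrow> real \<Rightarrow> 'a \<Rightarrow> real) \<Rightarrow> real \<Rightarrow> 'a set set" where
  "future_increments M B t = sigma_sets (space M)
     {(\<lambda>\<omega>. B i (t + s) \<omega> - B i t \<omega>) -` A \<inter> space M | i s A. i \<ge> 1 \<and> s \<ge> 0 \<and> A \<in> sets borel}"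

text \<open>Composing with \<open>max 0\<close> turns \<open>(F t)\<close>, \<open>t \<ge> 0\<close>, into a family indexed by all reals.\<close>

locale cbp_setting = prob_space M for M :: "'a measure" +
  fixes F :: "real \<Rightarrow> 'a measure"
    and B :: "nat \<Rightarrow> real \<Rightarrow> 'a \<Rightarrow> real"
    and x :: "nat \<Rightarrow> 'a \<Rightarrow> real"
  assumes filtration: "filtration (space M) (\<lambda>t. F (max 0 t))"
    and subalgebra: "\<And>t. t \<ge> 0 \<Longrightarrow> subalgebra M (F t)"
    and brownian: "\<And>j. j \<ge> 1 \<Longrightarrow> standard_brownian_motion (B j)"
    and brownian_adapted: "\<And>j. j \<ge> 1 \<Longrightarrow> adapted F (B j)"
    and brownian_indep:
      "indep_vars (\<lambda>_. Pi\<^sub>M {0..} (\<lambda>_. borel)) (\<lambda>j \<omega>. \<lambda>t\<in>{0..}. B j t \<omega>) {1..}"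
    and increments_indep: "\<And>t. t \<ge> 0 \<Longrightarrow> indep_set (future_increments M B t) (sets (F t))"
    and initial_measurable: "\<And>j. j \<ge> 1 \<Longrightarrow> x j \<in> borel_measurable (F 0)"
    and initial_sorted: "AE \<omega> in M. \<forall>j\<ge>1. x j \<omega> \<le> x (j + 1) \<omega>"

text \<open>
  The Lebesgue--Stieltjes measure of a continuous non-decreasing function on \<open>[0, \<infinity>)\<close>,
  continued as a constant to the negative half-line.
\<close>

definition stieltjes :: "(real \<Rightarrow> real) \<Rightarrow> real measure" where
  "stieltjes f = interval_measure (\<lambda>t. f (max 0 t))"

text \<open>
  The defining relations for individual paths: \<open>\<xi>\<close> are the initial positions, \<open>b\<close> the driving
  paths, \<open>X\<close> the particle paths and \<open>L\<close> the local times; \<open>1 - p\<close> is \<open>q\<close>.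
\<close>

definition cbp_paths ::
    "real \<Rightarrow> (nat \<Rightarrow> real) \<Rightarrow> (nat \<Rightarrow> real) \<Rightarrow> (nat \<Rightarrow> real \<Rightarrow> real) \<Rightarrow> (nat \<Rightarrow> real \<Rightarrow> real) \<Rightarrow>
     (nat \<Rightarrow> real \<Rightarrow> real) \<Rightarrow> bool" where
  "cbp_paths p g \<xi> b X L \<longleftrightarrow>
     (\<forall>j\<ge>1. continuous_on {0..} (X j)) \<and>
     (\<forall>j. continuous_on {0..} (L j)) \<and>
     (\<forall>t\<ge>0. \<forall>j\<ge>1. X j t = \<xi> j + g j * t + b j t + p * L (j - 1) t - (1 - p) * L j t) \<and>
     (\<forall>t\<ge>0. \<forall>j\<ge>1. X j t \<le> X (j + 1) t) \<and>
     (\<forall>t\<ge>0. L 0 t = 0) \<and>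
     (\<forall>j\<ge>1. mono_on {0..} (L j) \<and> L j 0 = 0 \<and>
        (\<integral>\<^sup>+t\<in>{0..}. ennreal (X (j + 1) t - X j t) \<partial>stieltjes (L j)) = 0)"

definition infinite_cbp ::
    "'a measure \<Rightarrow> (real \<Rightarrow> 'a measure) \<Rightarrow> real \<Rightarrow> (nat \<Rightarrow> real) \<Rightarrow> (nat \<Rightarrow> 'a \<Rightarrow> real) \<Rightarrow>
     (nat \<Rightarrow> real \<Rightarrow> 'a \<Rightarrow> real) \<Rightarrow> (nat \<Rightarrow> real \<Rightarrow> 'a \<Rightarrow> real) \<Rightarrow> bool" where
  "infinite_cbp M F p g x B X \<longleftrightarrow>
     (\<forall>j\<ge>1. adapted F (X j)) \<and>
     (\<exists>L. (\<forall>j. adapted F (L j)) \<and>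
       (AE \<omega> in M. cbp_paths p g (\<lambda>j. x j \<omega>) (\<lambda>j t. B j t \<omega>) (\<lambda>j t. X j t \<omega>) (\<lambda>j t. L j t \<omega>)))"

definition I_star ::
    "(nat \<Rightarrow> real \<Rightarrow> 'a \<Rightarrow> real) \<Rightarrow> nat \<Rightarrow> nat \<Rightarrow> real \<Rightarrow> 'a \<Rightarrow> real" where
  "I_star X M i T \<omega> = (INF s\<in>{0..T}. X (i + M) s \<omega>)"

end

theory Submission
  imports Defs
begin

text \<open>
  Since \<open>p < q\<close>, a collision pushes the lower particle down harder than it pushes the upper one
  up, so a crowded top would drag the lowest particle to \<open>-\<infinity>\<close>. Finiteness of
  \<open>X\<^sub>1\<close> at every time \<open>T + N\<close> therefore forces the configuration on \<open>[0, T]\<close> to be sparse at the top.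

  The pushes from below are removed by averaging. With \<open>a = 1 - p/q \<in> (0, 1]\<close> let \<open>Y\<^sub>1 = X\<^sub>1\<close> and
  \<open>Y\<^sub>k\<^sub>+\<^sub>1 = a X\<^sub>k\<^sub>+\<^sub>1 + (1 - a) Y\<^sub>k\<close>. The weights are such that every local time below level
  \<open>k\<close> enters \<open>Y\<^sub>k\<close> with a coefficient \<open>\<le> 0\<close>, and so does \<open>L\<^sub>k\<close> itself. Hence \<open>Y\<^sub>k\<close> grows no
  faster than the averaged driving noise \<open>W\<^sub>k\<close> plus a bounded drift, while ordering gives
  \<open>Y\<^sub>k \<le> Y\<^sub>k\<^sub>+\<^sub>1\<close> (\<open>geom_avg_increment_le\<close>, \<open>geom_avg_le_Suc\<close>). Just as for totally
  asymmetric collisions, this is a last passage bound: going forward in time one may descend from a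
  high level to level \<open>1\<close>, collecting at each moment the noise of the current level, and
  \<open>X\<^sub>1\<close> at the end is at most the high-level \<open>Y\<close> at the beginning plus the collected noise and drift
  (\<open>lowest_particle_le_descent\<close>).

  A crude choice of the descent suffices. Split \<open>[T, T + N]\<close> into \<open>n = m\<^sup>2\<close> equal pieces, go down one level
  per piece, and let the sign of \<open>B\<^sub>l\<^sub>+\<^sub>1\<close> over the piece decide whether to go from \<open>l + 1\<close> to \<open>l\<close>
  at its end or at its beginning. Each piece then contributes on average \<open>- c \<surd>(N/n)\<close> with \<open>c > 0\<close>, and the
  pieces are independent with second moment at most \<open>2N/n\<close>. The total is \<open>- c m \<surd>N + o(m)\<close>
  almost surely, because the normalised variances \<open>O(1/m\<^sup>2)\<close> are summable
  (\<open>descent_sum_asymptotics\<close>).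

  Passing from time \<open>T\<close> back to any \<open>s \<in> [0, T]\<close> costs at most the oscillation on \<open>[0, T]\<close> of the first
  \<open>n + 1\<close> Brownian motions, which is at most \<open>C m\<close> up to a constant factor, with a random \<open>C\<close>
  that does not depend on \<open>N\<close> (\<open>brownian_sup_growth\<close>, by dyadic chaining). Thus
  \<open>X\<^sub>n\<^sub>+\<^sub>1(s) \<ge> (c \<surd>N - 2C - o(1)) m\<close>, uniformly in \<open>s\<close>, and \<open>N\<close> is arbitrary. Monotonicity in the
  index fills the gaps between consecutive squares
  (\<open>cbp_paths_superdiffusive_lower_bound\<close>). Taking \<open>s = 0\<close> gives the claim on \<open>x\<close>.
\<close>

section \<open>Geometric averages of particle positions\<close>

text \<open>
  The weight of index \<open>k - i\<close> is \<open>a (1 - a)\<^sup>i\<close>, the remaining mass sitting at index \<open>1\<close>; index \<open>0\<close>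
  carries no particle, and the value there is chosen so that the average up to \<open>1\<close> is \<open>f 1\<close>.
\<close>

primrec geom_avg :: "real \<Rightarrow> (nat \<Rightarrow> real) \<Rightarrow> nat \<Rightarrow> real" where
  "geom_avg a f 0 = f 1"
| "geom_avg a f (Suc k) = a * f (Suc k) + (1 - a) * geom_avg a f k"

lemma geom_avg_1: "geom_avg a f (Suc 0) = f 1"
  by (simp add: algebra_simps)

lemma geom_avg_add: "geom_avg a (\<lambda>j. f j + h j) k = geom_avg a f k + geom_avg a h k"
  by (induction k) (simp_all add: algebra_simps)

lemma geom_avg_diff: "geom_avg a (\<lambda>j. f j - h j) k = geom_avg a f k - geom_avg a h k"
  using geom_avg_add[of a "\<lambda>j. f j - h j" h k] by simp

lemma geom_avg_const: "geom_avg a (\<lambda>j. c) k = c"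
  by (induction k) (simp_all add: algebra_simps)

lemma geom_avg_mono:
  assumes "0 \<le> a" "a \<le> 1" "1 \<le> k" "\<And>j. \<lbrakk>1 \<le> j; j \<le> k\<rbrakk> \<Longrightarrow> f j \<le> h j"
  shows "geom_avg a f k \<le> geom_avg a h k"
  using assms(3,4)
proof (induction k rule: nat_induct_at_least)
  case base
  then show ?case using geom_avg_1 by (simp add: algebra_simps)
next
  case (Suc k)
  then show ?case using assms(1,2) by (auto intro!: add_mono mult_left_mono)
qed

text \<open>Jensen's inequality for the square: a geometric average is an average with respect to a
  probability vector.\<close>

lemma geom_avg_power2_le:
  assumes "0 \<le> a" "a \<le> 1"
  shows "(geom_avg a f k)\<^sup>2 \<le> geom_avg a (\<lambda>j. (f j)\<^sup>2) k"
proof (induction k)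
  case (Suc k)
  have "(geom_avg a f (Suc k))\<^sup>2
      = a * (f (Suc k))\<^sup>2 + (1 - a) * (geom_avg a f k)\<^sup>2 - a * (1 - a) * (f (Suc k) - geom_avg a f k)\<^sup>2"
    by (simp add: power2_eq_square algebra_simps)
  also have "\<dots> \<le> a * (f (Suc k))\<^sup>2 + (1 - a) * (geom_avg a f k)\<^sup>2"
    using assms by simp
  also have "\<dots> \<le> a * (f (Suc k))\<^sup>2 + (1 - a) * geom_avg a (\<lambda>j. (f j)\<^sup>2) k"
    using assms Suc by (intro add_left_mono mult_left_mono) auto
  finally show ?case by simp
qed simp

lemma geom_avg_le_top:
  assumes "0 \<le> a" "a \<le> 1" "1 \<le> k" and "\<And>j. 1 \<le> j \<Longrightarrow> f j \<le> f (Suc j)"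
  shows "geom_avg a f k \<le> f k"
  using assms(3)
proof (induction k rule: nat_induct_at_least)
  case base
  then show ?case using geom_avg_1 by (simp add: algebra_simps)
next
  case (Suc k)
  have "geom_avg a f (Suc k) \<le> a * f (Suc k) + (1 - a) * f (Suc k)"
    using Suc assms(1,2) assms(4)[of k] by (auto intro!: mult_left_mono)
  then show ?case by (simp add: algebra_simps)
qed

lemma geom_avg_le_Suc:
  assumes "0 \<le> a" "a \<le> 1" "1 \<le> k" and "\<And>j. 1 \<le> j \<Longrightarrow> f j \<le> f (Suc j)"
  shows "geom_avg a f k \<le> geom_avg a f (Suc k)"
proof -
  have "geom_avg a f k \<le> f (Suc k)"
    using geom_avg_le_top[of a k f] assms(1-3) assms(4) assms(4)[of k] by force
  then have "a * geom_avg a f k \<le> a * f (Suc k)" using assms(1) by (rule mult_left_mono)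
  then show ?thesis by (simp add: algebra_simps)
qed

text \<open>
  For \<open>a = 1 - p/q\<close> one has \<open>a p = (1 - a) a q\<close>, so by induction the coefficient of \<open>L\<^sub>k\<close> in the
  average up to \<open>k\<close> is at most \<open>- a q = - (1 - 2 p)\<close>, and the upward push that \<open>L\<^sub>k\<close> gives to
  particle \<open>k + 1\<close> is absorbed when this particle is mixed in with weight \<open>a\<close>. What is left of the
  local times only decreases the average, so that only noise and drift can increase it.
\<close>

lemma geom_avg_increment_le:
  assumes "cbp_paths p g \<xi> b X L" and "0 \<le> p" "p < 1 / 2" and a: "a = (1 - 2 * p) / (1 - p)"
    and G: "\<And>j. 1 \<le> j \<Longrightarrow> \<bar>g j\<bar> \<le> G" and st: "0 \<le> s" "s \<le> t" and k: "1 \<le> k"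
  shows "geom_avg a (\<lambda>j. X j t) k
    \<le> geom_avg a (\<lambda>j. X j s) k + G * (t - s) + geom_avg a (\<lambda>j. b j t - b j s) k"
proof -
  have a01: "0 \<le> a" "a \<le> 1" unfolding a using assms(2,3) by (auto simp: field_simps)
  have aq: "a * (1 - p) = 1 - 2 * p" unfolding a using assms(3) by simp
  have "0 \<le> t" using st by simp
  have X: "X j u = \<xi> j + g j * u + b j u + p * L (j - 1) u - (1 - p) * L j u"
    if "u \<ge> 0" "j \<ge> 1" for j u
    using assms(1) that unfolding cbp_paths_def by blast
  have L0: "L 0 s = 0" "L 0 t = 0"
    using assms(1) st unfolding cbp_paths_def by auto
  have Lmono: "L j s \<le> L j t" if "1 \<le> j" for j
  proof -
    have "mono_on {0..} (L j)" using assms(1) that unfolding cbp_paths_def by blast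
    then show ?thesis using st \<open>0 \<le> t\<close> by (auto intro: mono_onD)
  qed
  have "geom_avg a (\<lambda>j. X j t - X j s) k
     \<le> geom_avg a (\<lambda>j. g j * (t - s) + (b j t - b j s)) k - (1 - 2 * p) * (L k t - L k s)"
    using k
  proof (induction k rule: nat_induct_at_least)
    case base
    have "(1 - 2 * p) * (L 1 t - L 1 s) \<le> (1 - p) * (L 1 t - L 1 s)"
      using Lmono[of 1] assms(2) by (intro mult_right_mono) auto
    moreover have "X 1 t - X 1 s = g 1 * (t - s) + (b 1 t - b 1 s) - (1 - p) * (L 1 t - L 1 s)"
      using X[of t 1] X[of s 1] st \<open>0 \<le> t\<close> L0 by (simp add: algebra_simps)
    ultimately show ?case using geom_avg_1[of a] by (simp del: geom_avg.simps)
  next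
    case (Suc k)
    define D where "D = L k t - L k s"
    define E where "E = L (Suc k) t - L (Suc k) s"
    define R where "R = g (Suc k) * (t - s) + (b (Suc k) t - b (Suc k) s)"
    have top: "X (Suc k) t - X (Suc k) s = R + p * D - (1 - p) * E"
      using X[of t "Suc k"] X[of s "Suc k"] st \<open>0 \<le> t\<close>
      unfolding R_def D_def E_def by (simp add: algebra_simps)
    \<comment> \<open>The choice of \<open>a\<close> makes the push \<open>p L\<^sub>k\<close> on particle \<open>k + 1\<close> cancel against
      the push on the average of the lower particles.\<close>
    have cancel: "a * p = (1 - a) * (1 - 2 * p)"
      unfolding a using assms(3) by (simp add: field_simps)
    have "geom_avg a (\<lambda>j. X j t - X j s) (Suc k)
       \<le> a * (R + p * D - (1 - p) * E)
         + (1 - a) * (geom_avg a (\<lambda>j. g j * (t - s) + (b j t - b j s)) k - (1 - 2 * p) * D)"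
      using Suc a01 top unfolding D_def by (simp add: mult_left_mono)
    also have "\<dots> = a * R + (1 - a) * geom_avg a (\<lambda>j. g j * (t - s) + (b j t - b j s)) k
        + (a * p - (1 - a) * (1 - 2 * p)) * D - (a * (1 - p)) * E"
      by (simp add: algebra_simps)
    finally show ?case using cancel aq by (simp add: R_def E_def)
  qed
  moreover have "0 \<le> (1 - 2 * p) * (L k t - L k s)"
    using Lmono[OF k] assms(3) by simp
  moreover have "geom_avg a (\<lambda>j. g j * (t - s)) k \<le> geom_avg a (\<lambda>j. G * (t - s)) k"
    using G st a01 k by (intro geom_avg_mono mult_right_mono) (auto dest: abs_le_D1)
  ultimately show ?thesis
    by (simp add: geom_avg_diff geom_avg_add geom_avg_const)
qed

section \<open>The descent bound for the lowest particle\<close>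

text \<open>
  The noise collected on a time interval on which the driving paths increase by \<open>\<beta>\<close>, when the path
  goes from level \<open>l + 1\<close> to level \<open>l\<close>. Deciding by the sign of \<open>\<beta> (l + 1)\<close> alone, instead of taking the
  smaller of the two averages, makes the mean explicit: \<open>\<beta> (l + 1)\<close> is independent of the lower
  coordinates.
\<close>

definition descent_step :: "real \<Rightarrow> (nat \<Rightarrow> real) \<Rightarrow> nat \<Rightarrow> real" where
  "descent_step a \<beta> l = (if \<beta> (Suc l) < 0 then geom_avg a \<beta> (Suc l) else geom_avg a \<beta> l)"

text \<open>
  On the interval from \<open>u m\<close> to \<open>u (m + 1)\<close> the path goes from level \<open>n - m + 1\<close> to \<open>n - m\<close>, at the
  end or at the beginning of the interval. A change of level only lowers the average by
  the ordering of the particles, and between changes the noise of the current level bounds its growth.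
\<close>

lemma lowest_particle_le_descent:
  assumes paths: "cbp_paths p g \<xi> b X L" and "0 \<le> p" "p < 1 / 2" and a: "a = (1 - 2 * p) / (1 - p)"
    and G: "\<And>j. 1 \<le> j \<Longrightarrow> \<bar>g j\<bar> \<le> G"
    and u0: "0 \<le> u 0" and u: "\<And>m. m < n \<Longrightarrow> u m \<le> u (Suc m)"
  shows "X 1 (u n) \<le> geom_avg a (\<lambda>j. X j (u 0)) (Suc n) + G * (u n - u 0)
    + (\<Sum>m<n. descent_step a (\<lambda>j. b j (u (Suc m)) - b j (u m)) (n - m))"
proof -
  define Y where "Y k t = geom_avg a (\<lambda>j. X j t) k" for k t
  define Z where "Z m = descent_step a (\<lambda>j. b j (u (Suc m)) - b j (u m)) (n - m)" for m
  have a01: "0 \<le> a" "a \<le> 1" unfolding a using assms(2,3) by (auto simp: field_simps)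
  have nonneg: "0 \<le> u m" if "m \<le> n" for m
    using that by (induction m) (use u0 u in \<open>auto intro: order_trans\<close>)
  have Y_Suc: "Y k t \<le> Y (Suc k) t" if "1 \<le> k" "0 \<le> t" for k t
    unfolding Y_def using paths that by (intro geom_avg_le_Suc a01) (auto simp: cbp_paths_def)
  have Y_inc: "Y k (u (Suc m)) \<le> Y k (u m) + G * (u (Suc m) - u m)
      + geom_avg a (\<lambda>j. b j (u (Suc m)) - b j (u m)) k" if "1 \<le> k" "m < n" for k m
    unfolding Y_def using that nonneg[of m] u[of m] assms(1-3)
    by (intro geom_avg_increment_le[where L = L and \<xi> = \<xi> and g = g and p = p] a G) auto
  have "Y (Suc n - m) (u m) \<le> Y (Suc n) (u 0) + G * (u m - u 0) + (\<Sum>i<m. Z i)" if "m \<le> n" for m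
    using that
  proof (induction m)
    case (Suc m)
    define l where "l = n - m"
    have l: "1 \<le> l" "Suc n - m = Suc l" "Suc n - Suc m = l" using Suc.prems by (auto simp: l_def)
    have "Y l (u (Suc m)) \<le> Y (Suc l) (u m) + G * (u (Suc m) - u m) + Z m"
    proof (cases "b (Suc l) (u (Suc m)) - b (Suc l) (u m) < 0")
      case True
      then have "Z m = geom_avg a (\<lambda>j. b j (u (Suc m)) - b j (u m)) (Suc l)"
        unfolding Z_def descent_step_def l_def by auto
      then show ?thesis
        using Y_inc[of "Suc l" m] Y_Suc[of l "u (Suc m)"] Suc.prems l nonneg[of "Suc m"] by auto
    next
      case False
      then have "Z m = geom_avg a (\<lambda>j. b j (u (Suc m)) - b j (u m)) l"
        unfolding Z_def descent_step_def l_def by auto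
      then show ?thesis
        using Y_inc[of l m] Y_Suc[of l "u m"] Suc.prems l nonneg[of m] by auto
    qed
    moreover have "Y (Suc l) (u m) \<le> Y (Suc n) (u 0) + G * (u m - u 0) + (\<Sum>i<m. Z i)"
      using Suc l by simp
    ultimately show ?case unfolding l(3) by (simp add: algebra_simps)
  qed simp
  from this[of n] show ?thesis
    unfolding Y_def Z_def by (simp add: algebra_simps)
qed

section \<open>Dyadic chaining\<close>

text \<open>An odd grid point of level \<open>n + 1\<close> is one step away from a grid point of level \<open>n\<close>.\<close>

lemma dyadic_grid_bound:
  fixes f :: "real \<Rightarrow> real"
  assumes inc: "\<And>n i. i < 2 ^ n \<Longrightarrow> \<bar>f (real (Suc i) * T / 2 ^ n) - f (real i * T / 2 ^ n)\<bar> \<le> K * r ^ n"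
    and "i \<le> 2 ^ n"
  shows "\<bar>f (real i * T / 2 ^ n) - f 0\<bar> \<le> K * (\<Sum>m\<le>n. r ^ m)"
  using assms(2)
proof (induction n arbitrary: i)
  case 0
  then have "i = 0 \<or> i = 1" by auto
  moreover have "0 \<le> K" using inc[of 0 0] by (smt (verit) abs_ge_zero less_numeral_extra(1) mult_cancel_left1 power_0)
  ultimately show ?case using inc[of 0 0] by auto
next
  case (Suc n)
  have pos: "0 \<le> K * r ^ Suc n" by (rule order_trans[OF abs_ge_zero inc[of 0 "Suc n"]]) simp
  have half: "real (2 * i') * T / 2 ^ Suc n = real i' * T / 2 ^ n" for i'
    by simp
  show ?case
  proof (cases "even i")
    case True
    then obtain i' where i': "i = 2 * i'" by blast
    then have "i' \<le> 2 ^ n" using Suc.prems by simp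
    then show ?thesis
      using Suc.IH[of i'] pos unfolding i' half by (simp add: algebra_simps)
  next
    case False
    then obtain i' where i': "i = Suc (2 * i')" by (metis oddE Suc_eq_plus1)
    then have less: "2 * i' < 2 ^ Suc n" "i' \<le> 2 ^ n" using Suc.prems by auto
    have "\<bar>f (real i * T / 2 ^ Suc n) - f (real i' * T / 2 ^ n)\<bar> \<le> K * r ^ Suc n"
      using inc[OF less(1)] unfolding i' half .
    then show ?thesis
      using Suc.IH[OF less(2)] by (simp add: algebra_simps)
  qed
qed

text \<open>Dyadic points are dense, so by continuity the geometric series of the grid bounds controls
  the whole path.\<close>

lemma dyadic_chaining:
  fixes f :: "real \<Rightarrow> real"
  assumes cont: "continuous_on {0..T} f" and T: "0 < T" and r: "0 \<le> r" "r < 1"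
    and inc: "\<And>n i. i < 2 ^ n \<Longrightarrow> \<bar>f (real (Suc i) * T / 2 ^ n) - f (real i * T / 2 ^ n)\<bar> \<le> K * r ^ n"
    and s: "s \<in> {0..T}"
  shows "\<bar>f s - f 0\<bar> \<le> K / (1 - r)"
proof -
  have K: "0 \<le> K" using inc[of 0 0] by (smt (verit) abs_ge_zero less_numeral_extra(1) mult_cancel_left1 power_0)
  define i where "i n = nat \<lfloor>s * 2 ^ n / T\<rfloor>" for n :: nat
  define d where "d n = real (i n) * T / 2 ^ n" for n
  have i: "real (i n) \<le> s * 2 ^ n / T" "s * 2 ^ n / T < real (i n) + 1" for n
    using s T unfolding i_def by (auto simp: of_nat_nat)
  have d: "d n \<le> s" "s - T * (1/2) ^ n \<le> d n" "0 \<le> d n" for n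
  proof -
    have lower: "s - T * (1/2) ^ n = (s * 2 ^ n - T) / 2 ^ n"
      by (simp add: field_simps power_divide)
    show "d n \<le> s" "0 \<le> d n" using i[of n] T unfolding d_def by (auto simp: field_simps)
    show "s - T * (1/2) ^ n \<le> d n"
      unfolding lower d_def using i[of n] T by (intro divide_right_mono) (auto simp: field_simps)
  qed
  have i_le: "i n \<le> 2 ^ n" for n
  proof -
    have "real (i n) \<le> 2 ^ n"
      using i(1)[of n] s T by (smt (verit, ccfv_SIG) atLeastAtMost_iff divide_le_eq mult_left_mono
        zero_less_power mult.commute)
    then show ?thesis by (metis of_nat_le_iff of_nat_numeral of_nat_power)
  qed
  have "(\<lambda>n. s - T * (1/2) ^ n) \<longlonglongrightarrow> s - T * 0"
    by (intro tendsto_intros LIMSEQ_power_zero) auto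
  then have "d \<longlonglongrightarrow> s"
    by (intro tendsto_sandwich[of _ d sequentially "\<lambda>_. s"] always_eventually allI) (use d in auto)
  then have "(\<lambda>n. f (d n)) \<longlonglongrightarrow> f s"
    using d s by (intro continuous_on_tendsto_compose[OF cont]) (auto intro!: always_eventually intro: order_trans)
  then have "(\<lambda>n. \<bar>f (d n) - f 0\<bar>) \<longlonglongrightarrow> \<bar>f s - f 0\<bar>"
    by (intro tendsto_intros)
  moreover have "\<bar>f (d n) - f 0\<bar> \<le> K / (1 - r)" for n
  proof -
    have "\<bar>f (d n) - f 0\<bar> \<le> K * (\<Sum>m\<le>n. r ^ m)"
      unfolding d_def by (rule dyadic_grid_bound[OF inc i_le])
    also have "(\<Sum>m\<le>n. r ^ m) \<le> (\<Sum>m. r ^ m)"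
      using r by (intro sum_le_suminf summable_geometric) auto
    then have "K * (\<Sum>m\<le>n. r ^ m) \<le> K * (\<Sum>m. r ^ m)" using K by (intro mult_left_mono)
    also have "\<dots> = K / (1 - r)" using r by (simp add: suminf_geometric)
    finally show ?thesis .
  qed
  ultimately show ?thesis by (intro LIMSEQ_le_const2) auto
qed

section \<open>Moment tools\<close>

text \<open>The sum of the \<open>f n\<close> has a finite expectation, so it is almost surely finite.\<close>

lemma (in prob_space) AE_tendsto_0_of_summable_expectation:
  fixes f :: "nat \<Rightarrow> 'a \<Rightarrow> real"
  assumes f: "\<And>n. integrable M (f n)" "\<And>n \<omega>. 0 \<le> f n \<omega>"
    and c: "\<And>n. expectation (f n) \<le> c n" "summable c"
  shows "AE \<omega> in M. (\<lambda>n. f n \<omega>) \<longlonglongrightarrow> 0"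
proof -
  have [measurable]: "f n \<in> borel_measurable M" for n using f(1) by auto
  have summ: "summable (\<lambda>n. expectation (f n))"
    using f c by (intro summable_comparison_test'[OF c(2)]) (auto intro: integral_nonneg)
  have "(\<integral>\<^sup>+\<omega>. (\<Sum>n. ennreal (f n \<omega>)) \<partial>M) = (\<Sum>n. \<integral>\<^sup>+\<omega>. ennreal (f n \<omega>) \<partial>M)"
    by (rule nn_integral_suminf) simp
  also have "\<dots> = (\<Sum>n. ennreal (expectation (f n)))"
    using f by (intro suminf_cong nn_integral_eq_integral) auto
  also have "\<dots> = ennreal (\<Sum>n. expectation (f n))"
    using f summ by (intro suminf_ennreal2) (auto intro: integral_nonneg)
  finally have "(\<integral>\<^sup>+\<omega>. (\<Sum>n. ennreal (f n \<omega>)) \<partial>M) \<noteq> \<infinity>" by simp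
  then have "AE \<omega> in M. (\<Sum>n. ennreal (f n \<omega>)) \<noteq> \<infinity>"
    by (intro nn_integral_noteq_infinite) auto
  then show ?thesis
  proof eventually_elim
    case (elim \<omega>)
    then have "summable (\<lambda>n. f n \<omega>)" using f(2) by (intro summable_suminf_not_top) auto
    then show ?case by (rule summable_LIMSEQ_zero)
  qed
qed

lemma (in prob_space) variance_indep_sum_le:
  fixes Z :: "nat \<Rightarrow> 'a \<Rightarrow> real"
  assumes Z: "\<And>m. m < n \<Longrightarrow> integrable M (Z m)" "\<And>m. m < n \<Longrightarrow> integrable M (\<lambda>\<omega>. (Z m \<omega>)\<^sup>2)"
    and C: "\<And>m. m < n \<Longrightarrow> expectation (\<lambda>\<omega>. (Z m \<omega>)\<^sup>2) \<le> C"
    and indep: "\<And>m m'. \<lbrakk>m < m'; m' < n\<rbrakk> \<Longrightarrow> indep_var borel (Z m) borel (Z m')"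
  shows "integrable M (\<lambda>\<omega>. (\<Sum>m<n. Z m \<omega> - expectation (Z m))\<^sup>2)"
    and "expectation (\<lambda>\<omega>. (\<Sum>m<n. Z m \<omega> - expectation (Z m))\<^sup>2) \<le> n * C"
proof -
  define D where "D m \<omega> = Z m \<omega> - expectation (Z m)" for m \<omega>
  have prod: "has_bochner_integral M (\<lambda>\<omega>. D m \<omega> * D m' \<omega>)
      (if m = m' then expectation (\<lambda>\<omega>. (Z m \<omega>)\<^sup>2) - (expectation (Z m))\<^sup>2 else 0)"
    if "m < n" "m' < n" for m m'
  proof (cases "m = m'")
    case True
    have "(\<lambda>\<omega>. D m \<omega> * D m \<omega>) = (\<lambda>\<omega>. (Z m \<omega>)\<^sup>2 - 2 * expectation (Z m) * Z m \<omega> + (expectation (Z m))\<^sup>2)"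
      unfolding D_def by (auto simp: power2_eq_square algebra_simps)
    then show ?thesis using Z[OF that(1)] True
      by (auto simp: has_bochner_integral_iff prob_space power2_eq_square)
  next
    case False
    have zero: "has_bochner_integral M (\<lambda>\<omega>. D m \<omega> * D m' \<omega>) 0"
      if "m < m'" "m' < n" for m m'
    proof -
      note ind = indep[OF that]
      have "m < n" using that by simp
      have "(\<lambda>\<omega>. D m \<omega> * D m' \<omega>) = (\<lambda>\<omega>. Z m \<omega> * Z m' \<omega> - expectation (Z m) * Z m' \<omega>
          - expectation (Z m') * Z m \<omega> + expectation (Z m) * expectation (Z m'))"
        unfolding D_def by (auto simp: algebra_simps)
      then show ?thesis
        using Z[OF \<open>m < n\<close>] Z[OF that(2)] indep_var_integrable[OF ind]
          indep_var_lebesgue_integral[OF ind]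
        by (auto simp: has_bochner_integral_iff prob_space)
    qed
    show ?thesis
    proof (cases "m < m'")
      case True
      then show ?thesis using zero[of m m'] that by simp
    next
      case False
      then show ?thesis
        using zero[of m' m] that \<open>m \<noteq> m'\<close> by (simp add: mult.commute)
    qed
  qed
  have "has_bochner_integral M (\<lambda>\<omega>. \<Sum>m<n. \<Sum>m'<n. D m \<omega> * D m' \<omega>)
      (\<Sum>m<n. \<Sum>m'<n. if m = m' then expectation (\<lambda>\<omega>. (Z m \<omega>)\<^sup>2) - (expectation (Z m))\<^sup>2 else 0)"
    by (intro has_bochner_integral_sum prod) auto
  also have "(\<lambda>\<omega>. \<Sum>m<n. \<Sum>m'<n. D m \<omega> * D m' \<omega>) = (\<lambda>\<omega>. (\<Sum>m<n. D m \<omega>)\<^sup>2)"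
    by (simp add: power2_eq_square sum_product)
  finally have sq: "has_bochner_integral M (\<lambda>\<omega>. (\<Sum>m<n. D m \<omega>)\<^sup>2)
      (\<Sum>m<n. expectation (\<lambda>\<omega>. (Z m \<omega>)\<^sup>2) - (expectation (Z m))\<^sup>2)"
    by (simp add: sum.delta)
  have "(\<Sum>m<n. expectation (\<lambda>\<omega>. (Z m \<omega>)\<^sup>2) - (expectation (Z m))\<^sup>2) \<le> (\<Sum>m<n. C)"
    using C by (intro sum_mono) (smt (verit) lessThan_iff zero_le_power2)
  then show "integrable M (\<lambda>\<omega>. (\<Sum>m<n. Z m \<omega> - expectation (Z m))\<^sup>2)"
    and "expectation (\<lambda>\<omega>. (\<Sum>m<n. Z m \<omega> - expectation (Z m))\<^sup>2) \<le> n * C"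
    using sq by (auto simp: has_bochner_integral_iff D_def)
qed

lemma (in prob_space) brownian_increment_moments:
  assumes "standard_brownian_motion W" "0 \<le> s" "s < t"
  defines "D \<equiv> \<lambda>\<omega>. W t \<omega> - W s \<omega>"
  shows "has_bochner_integral M D 0"
    and "has_bochner_integral M (\<lambda>\<omega>. \<bar>D \<omega>\<bar>) (sqrt (2 / pi) * sqrt (t - s))"
    and "has_bochner_integral M (\<lambda>\<omega>. (D \<omega>)\<^sup>2) (t - s)"
    and "has_bochner_integral M (\<lambda>\<omega>. (D \<omega>) ^ 4) (3 * (t - s)\<^sup>2)"
proof -
  define \<sigma> where "\<sigma> = sqrt (t - s)"
  have \<sigma>: "0 < \<sigma>" "\<sigma>\<^sup>2 = t - s" using assms by (auto simp: \<sigma>_def)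
  have D: "distributed M lborel D (normal_density 0 \<sigma>)"
    unfolding D_def \<sigma>_def using assms(1-3) unfolding standard_brownian_motion_def by blast
  have tr: "has_bochner_integral M (\<lambda>\<omega>. h (D \<omega>)) c"
    if "has_bochner_integral lborel (\<lambda>x. normal_density 0 \<sigma> x * h x) c" "h \<in> borel_measurable lborel" for h c
    using that distributed_integrable[OF D that(2)] distributed_integral[OF D that(2)]
    by (auto simp: has_bochner_integral_iff normal_density_nonneg)
  show "has_bochner_integral M D 0"
    using tr[of "\<lambda>x. x" 0] normal_moment_odd[OF \<sigma>(1), of 0 0] by simp
  show "has_bochner_integral M (\<lambda>\<omega>. \<bar>D \<omega>\<bar>) (sqrt (2 / pi) * sqrt (t - s))"
    using tr[of abs] normal_moment_abs_odd[OF \<sigma>(1), of 0 0] by (simp add: \<sigma>_def mult.commute)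
  show "has_bochner_integral M (\<lambda>\<omega>. (D \<omega>)\<^sup>2) (t - s)"
    using tr[of "\<lambda>x. x\<^sup>2"] normal_moment_even[OF \<sigma>(1), of 0 1] \<sigma> by (simp add: fact_numeral diff_divide_distrib)
  have "24 / ((2 / (t - s))\<^sup>2 * 2) = 3 * (t - s)\<^sup>2" by (simp add: field_simps power2_eq_square)
  then show "has_bochner_integral M (\<lambda>\<omega>. (D \<omega>) ^ 4) (3 * (t - s)\<^sup>2)"
    using tr[of "\<lambda>x. x ^ 4"] normal_moment_even[OF \<sigma>(1), of 0 2] \<sigma> by (simp add: fact_numeral)
qed

lemma geom_avg_measurable:
  assumes "\<And>j. 1 \<le> j \<Longrightarrow> f j \<in> borel_measurable N"
  shows "(\<lambda>\<omega>. geom_avg a (\<lambda>j. f j \<omega>) k) \<in> borel_measurable N"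
proof (induction k)
  case 0
  then show ?case using assms by simp
next
  case (Suc k)
  have "f (Suc k) \<in> borel_measurable N" using assms by simp
  with Suc show ?case by simp
qed

lemma descent_step_measurable:
  assumes "\<And>j. 1 \<le> j \<Longrightarrow> f j \<in> borel_measurable N"
  shows "(\<lambda>\<omega>. descent_step a (\<lambda>j. f j \<omega>) l) \<in> borel_measurable N"
proof -
  have [measurable]: "f (Suc l) \<in> borel_measurable N" using assms by simp
  note [measurable] = geom_avg_measurable[OF assms]
  show ?thesis unfolding descent_step_def by measurable
qed

section \<open>Noise collected on one time interval\<close>

context cbp_setting
begin

definition increment :: "real \<Rightarrow> real \<Rightarrow> nat \<Rightarrow> 'a \<Rightarrow> real" where
  "increment s t j \<omega> = B j t \<omega> - B j s \<omega>"

lemma brownian_measurable: "\<lbrakk>1 \<le> j; 0 \<le> t\<rbrakk> \<Longrightarrow> B j t \<in> borel_measurable M"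
  using brownian[of j] unfolding standard_brownian_motion_def by blast

lemma increment_measurable: "\<lbrakk>1 \<le> j; 0 \<le> s; s \<le> t\<rbrakk> \<Longrightarrow> increment s t j \<in> borel_measurable M"
  unfolding increment_def by (intro borel_measurable_diff brownian_measurable) auto

lemma increment_moments:
  assumes "1 \<le> j" "0 \<le> s" "s < t"
  shows "has_bochner_integral M (increment s t j) 0"
    and "has_bochner_integral M (\<lambda>\<omega>. \<bar>increment s t j \<omega>\<bar>) (sqrt (2 / pi) * sqrt (t - s))"
    and "has_bochner_integral M (\<lambda>\<omega>. (increment s t j \<omega>)\<^sup>2) (t - s)"
    and "has_bochner_integral M (\<lambda>\<omega>. (increment s t j \<omega>) ^ 4) (3 * (t - s)\<^sup>2)"
  using brownian_increment_moments[OF brownian[OF assms(1)] assms(2,3)]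
  unfolding increment_def[abs_def] by auto

lemma increments_of_distinct_particles_indep:
  assumes "1 \<le> j" "1 \<le> k" "j \<noteq> k" "0 \<le> s" "0 \<le> t"
  shows "indep_var borel (increment s t j) borel (increment s t k)"
proof -
  have "indep_vars (\<lambda>_. borel) (\<lambda>i \<omega>. (\<lambda>h. h t - h s) (\<lambda>u\<in>{0..}. B i u \<omega>)) {1..}"
    using assms by (intro indep_vars_compose2[OF brownian_indep]) auto
  then have "indep_vars (\<lambda>_. borel) (increment s t) {1..}"
    using assms by (simp add: increment_def[abs_def])
  then have "indep_var (PiM {j} (\<lambda>_. borel)) (\<lambda>\<omega>. restrict (\<lambda>i. increment s t i \<omega>) {j})
      (PiM {k} (\<lambda>_. borel)) (\<lambda>\<omega>. restrict (\<lambda>i. increment s t i \<omega>) {k})"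
    using assms by (intro indep_var_restrict) auto
  then have "indep_var borel ((\<lambda>h. h j) \<circ> (\<lambda>\<omega>. restrict (\<lambda>i. increment s t i \<omega>) {j}))
      borel ((\<lambda>h. h k) \<circ> (\<lambda>\<omega>. restrict (\<lambda>i. increment s t i \<omega>) {k}))"
    by (rule indep_var_compose) auto
  then show ?thesis by (simp add: comp_def)
qed

text \<open>The earlier step is measurable with respect to the past of \<open>s'\<close>, the later one is a function of
  the driving increments after \<open>s'\<close>.\<close>

lemma descent_step_indep:
  assumes "0 \<le> s" "s \<le> t" "t \<le> s'" "s' \<le> t'"
  shows "indep_var borel (\<lambda>\<omega>. descent_step a (\<lambda>j. increment s t j \<omega>) l)
    borel (\<lambda>\<omega>. descent_step a (\<lambda>j. increment s' t' j \<omega>) l')"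
proof -
  let ?Z = "\<lambda>\<omega>. descent_step a (\<lambda>j. increment s t j \<omega>) l"
  let ?Z' = "\<lambda>\<omega>. descent_step a (\<lambda>j. increment s' t' j \<omega>) l'"
  let ?S = "sigma (space M) (future_increments M B s')"
  have sp: "space (F u) = space M" if "0 \<le> u" for u
    using subalgebra[OF that] by (simp add: subalgebra_def)
  have past: "?Z \<in> borel_measurable (F s')"
  proof (rule descent_step_measurable)
    fix j :: nat assume j: "1 \<le> j"
    have "B j u \<in> borel_measurable (F s')" if "0 \<le> u" "u \<le> s'" for u
    proof -
      have "sets (F u) \<subseteq> sets (F s')"
        using filtration.sets_F_mono[OF filtration, of u s'] that by simp
      moreover have "B j u \<in> borel_measurable (F u)"
        using brownian_adapted[OF j] that by (simp add: adapted_def)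
      ultimately show ?thesis
        using that sp by (intro measurable_mono[THEN subsetD, OF order_refl refl, of "F u" "F s'"]) auto
    qed
    then show "increment s t j \<in> borel_measurable (F s')"
      unfolding increment_def using assms by (intro borel_measurable_diff) auto
  qed
  have fut_sub: "future_increments M B s' \<subseteq> Pow (space M)"
    unfolding future_increments_def by (intro subsetI PowI sigma_sets_into_sp) auto
  have fut_sets: "sets ?S = future_increments M B s'"
    unfolding sets_measure_of[OF fut_sub] unfolding future_increments_def
    by (rule sigma_sets_sigma_sets_eq) auto
  have future: "?Z' \<in> borel_measurable ?S"
  proof (rule descent_step_measurable)
    fix j :: nat assume j: "1 \<le> j"
    show "increment s' t' j \<in> borel_measurable ?S"
    proof (rule measurableI)
      fix A :: "real set" assume A: "A \<in> sets borel"
      have "increment s' t' j -` A \<inter> space M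
          = (\<lambda>\<omega>. B j (s' + (t' - s')) \<omega> - B j s' \<omega>) -` A \<inter> space M"
        by (simp add: increment_def[abs_def])
      also have "\<dots> \<in> future_increments M B s'"
        unfolding future_increments_def using j A assms
        by (intro sigma_sets.Basic CollectI exI[of _ j] exI[of _ "t' - s'"] exI[of _ A]) auto
      finally show "increment s' t' j -` A \<inter> space ?S \<in> sets ?S"
        using fut_sets by (simp add: space_measure_of[OF fut_sub])
    qed auto
  qed
  have gen: "sigma_sets (space M) {Z -` A \<inter> space M |A. A \<in> sets borel} \<subseteq> sets N"
    if "Z \<in> borel_measurable N" "space N = space M" for Z :: "'a \<Rightarrow> real" and N
  proof -
    have "{Z -` A \<inter> space N |A. A \<in> sets borel} \<subseteq> sets N"
      using measurable_sets[OF that(1)] by auto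
    then show ?thesis unfolding that(2)[symmetric] by (rule sets.sigma_sets_subset)
  qed
  have "0 \<le> s'" using assms by simp
  note ind = increments_indep[OF this, unfolded indep_sets2_eq]
  have rv: "?Z \<in> borel_measurable M" "?Z' \<in> borel_measurable M"
    using assms by (auto intro!: descent_step_measurable increment_measurable)
  show ?thesis
    unfolding indep_var_eq indep_sets2_eq
  proof (intro conjI rv ballI)
    show "sigma_sets (space M) {?Z -` A \<inter> space M |A. A \<in> sets borel} \<subseteq> events"
      "sigma_sets (space M) {?Z' -` A \<inter> space M |A. A \<in> sets borel} \<subseteq> events"
      by (rule gen[OF rv(1) refl] gen[OF rv(2) refl])+
    fix E E' assume "E \<in> sigma_sets (space M) {?Z -` A \<inter> space M |A. A \<in> sets borel}"
      "E' \<in> sigma_sets (space M) {?Z' -` A \<inter> space M |A. A \<in> sets borel}"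
    then have "E \<in> sets (F s')" "E' \<in> future_increments M B s'"
      using gen[OF past sp[OF \<open>0 \<le> s'\<close>]] gen[OF future space_measure_of[OF fut_sub]] fut_sets by auto
    then show "prob (E \<inter> E') = prob E * prob E'"
      using ind by (metis Int_commute mult.commute)
  qed
qed

text \<open>
  With \<open>W\<^sub>l\<close> the average of the increments and \<open>D\<close> the increment of particle \<open>l + 1\<close>, the step is
  \<open>W\<^sub>l + a (D - W\<^sub>l) 1{D < 0}\<close>. The average \<open>W\<^sub>l\<close> is centred and independent of the sign of \<open>D\<close>, so the mean is
  \<open>a E[D; D < 0] = - a E\<bar>D\<bar> / 2\<close>. For the second moment, the step equals \<open>W\<^sub>l\<close> or \<open>W\<^sub>l\<^sub>+\<^sub>1\<close>, each of which has
  second moment at most \<open>t - s\<close> by convexity.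
\<close>

lemma descent_step_moments:
  assumes a: "0 \<le> a" "a \<le> 1" and st: "0 \<le> s" "s < t" and l: "1 \<le> l"
  defines "Z \<equiv> \<lambda>\<omega>. descent_step a (\<lambda>j. increment s t j \<omega>) l"
  shows "has_bochner_integral M Z (- (a * sqrt (2 / pi) / 2) * sqrt (t - s))"
    and "integrable M (\<lambda>\<omega>. (Z \<omega>)\<^sup>2)"
    and "expectation (\<lambda>\<omega>. (Z \<omega>)\<^sup>2) \<le> 2 * (t - s)"
proof -
  define W where "W k \<omega> = geom_avg a (\<lambda>j. increment s t j \<omega>) k" for k \<omega>
  define D where "D = increment s t (Suc l)"
  define neg where "neg x = (if x < 0 then 1 else 0 :: real)" for x :: real
  have [measurable]: "D \<in> borel_measurable M" "neg \<in> borel_measurable borel"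
    using st unfolding D_def neg_def by (auto intro: increment_measurable)
  have W_meas[measurable]: "W k \<in> borel_measurable M" for k
    unfolding W_def using st by (intro geom_avg_measurable increment_measurable) auto
  have [measurable]: "Z \<in> borel_measurable M"
    unfolding Z_def using st by (intro descent_step_measurable increment_measurable) auto
  have moments: "has_bochner_integral M (W k) 0"
      "has_bochner_integral M (\<lambda>\<omega>. geom_avg a (\<lambda>j. (increment s t j \<omega>)\<^sup>2) k) (t - s)" for k
  proof -
    show "has_bochner_integral M (W k) 0"
    proof (induction k)
      case (Suc k)
      have "has_bochner_integral M (\<lambda>\<omega>. a * increment s t (Suc k) \<omega> + (1 - a) * W k \<omega>)
          (a * 0 + (1 - a) * 0)"
        using increment_moments(1)[of "Suc k", OF _ st] Suc
        by (intro has_bochner_integral_add has_bochner_integral_mult_right) auto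
      then show ?case by (simp add: W_def[abs_def])
    qed (use increment_moments(1)[of 1, OF _ st] in \<open>simp add: W_def[abs_def]\<close>)
    show "has_bochner_integral M (\<lambda>\<omega>. geom_avg a (\<lambda>j. (increment s t j \<omega>)\<^sup>2) k) (t - s)"
    proof (induction k)
      case (Suc k)
      have "has_bochner_integral M (\<lambda>\<omega>. a * (increment s t (Suc k) \<omega>)\<^sup>2
          + (1 - a) * geom_avg a (\<lambda>j. (increment s t j \<omega>)\<^sup>2) k) (a * (t - s) + (1 - a) * (t - s))"
        using increment_moments(3)[of "Suc k", OF _ st] Suc
        by (intro has_bochner_integral_add has_bochner_integral_mult_right) auto
      moreover have "a * (t - s) + (1 - a) * (t - s) = t - s" by (simp add: algebra_simps)
      ultimately show ?case by simp
    qed (use increment_moments(3)[of 1, OF _ st] in simp)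
  qed
  have W2: "integrable M (\<lambda>\<omega>. (W k \<omega>)\<^sup>2)" "expectation (\<lambda>\<omega>. (W k \<omega>)\<^sup>2) \<le> t - s" for k
  proof -
    note m = moments(2)[of k, unfolded has_bochner_integral_iff]
    have le: "(W k \<omega>)\<^sup>2 \<le> geom_avg a (\<lambda>j. (increment s t j \<omega>)\<^sup>2) k" for \<omega>
      unfolding W_def by (rule geom_avg_power2_le[OF a])
    show i: "integrable M (\<lambda>\<omega>. (W k \<omega>)\<^sup>2)"
    proof (rule Bochner_Integration.integrable_bound[OF conjunct1[OF m]])
      show "AE \<omega> in M. norm ((W k \<omega>)\<^sup>2) \<le> norm (geom_avg a (\<lambda>j. (increment s t j \<omega>)\<^sup>2) k)"
        using le by (intro AE_I2) (simp add: order_trans[OF _ abs_ge_self])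
    qed simp
    have "expectation (\<lambda>\<omega>. (W k \<omega>)\<^sup>2) \<le> expectation (\<lambda>\<omega>. geom_avg a (\<lambda>j. (increment s t j \<omega>)\<^sup>2) k)"
      using conjunct1[OF m] i le by (intro integral_mono) auto
    then show "expectation (\<lambda>\<omega>. (W k \<omega>)\<^sup>2) \<le> t - s" using m by simp
  qed
  have below: "has_bochner_integral M (\<lambda>\<omega>. increment s t j \<omega> * neg (D \<omega>)) 0" if "1 \<le> j" "j \<le> l" for j
  proof -
    have "indep_var borel (id \<circ> increment s t j) borel (neg \<circ> D)"
      using that st unfolding D_def
      by (intro indep_var_compose[OF increments_of_distinct_particles_indep]) auto
    then have ind: "indep_var borel (increment s t j) borel (\<lambda>\<omega>. neg (D \<omega>))"
      by (simp add: comp_def)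
    have "integrable M (\<lambda>\<omega>. neg (D \<omega>))"
      by (rule integrable_const_bound[where B = 1]) (auto simp: neg_def)
    then show ?thesis
      using increment_moments(1)[OF that(1) st] indep_var_integrable[OF ind]
        indep_var_lebesgue_integral[OF ind] by (simp add: has_bochner_integral_iff)
  qed
  have W_neg: "has_bochner_integral M (\<lambda>\<omega>. W k \<omega> * neg (D \<omega>)) 0" if "k \<le> l" for k
    using that
  proof (induction k)
    case (Suc k)
    have "has_bochner_integral M (\<lambda>\<omega>. a * (increment s t (Suc k) \<omega> * neg (D \<omega>))
        + (1 - a) * (W k \<omega> * neg (D \<omega>))) (a * 0 + (1 - a) * 0)"
      using below[of "Suc k"] Suc
      by (intro has_bochner_integral_add has_bochner_integral_mult_right) auto
    then show ?case by (simp add: W_def[abs_def] algebra_simps)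
  qed (use below[of 1] l in \<open>simp add: W_def[abs_def]\<close>)
  have D_neg: "has_bochner_integral M (\<lambda>\<omega>. D \<omega> * neg (D \<omega>)) (- (sqrt (2 / pi) * sqrt (t - s)) / 2)"
  proof -
    have "has_bochner_integral M (\<lambda>\<omega>. (D \<omega> - \<bar>D \<omega>\<bar>) / 2) ((0 - sqrt (2 / pi) * sqrt (t - s)) / 2)"
      using increment_moments(1,2)[of "Suc l", OF _ st] unfolding D_def
      by (intro has_bochner_integral_divide_zero has_bochner_integral_diff) auto
    moreover have "(\<lambda>\<omega>. (D \<omega> - \<bar>D \<omega>\<bar>) / 2) = (\<lambda>\<omega>. D \<omega> * neg (D \<omega>))"
      by (auto simp: neg_def)
    ultimately show ?thesis by simp
  qed
  have Z_eq: "Z \<omega> = W l \<omega> + a * (D \<omega> * neg (D \<omega>)) - a * (W l \<omega> * neg (D \<omega>))" for \<omega>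
    by (simp add: Z_def descent_step_def W_def D_def neg_def algebra_simps)
  have "has_bochner_integral M (\<lambda>\<omega>. W l \<omega> + a * (D \<omega> * neg (D \<omega>)) - a * (W l \<omega> * neg (D \<omega>)))
      (0 + a * (- (sqrt (2 / pi) * sqrt (t - s)) / 2) - a * 0)"
    using W_neg[of l]
    by (intro has_bochner_integral_add has_bochner_integral_diff has_bochner_integral_mult_right
        moments D_neg) auto
  then show "has_bochner_integral M Z (- (a * sqrt (2 / pi) / 2) * sqrt (t - s))"
    unfolding Z_eq[abs_def, symmetric] by (simp add: algebra_simps)
  have bound: "(Z \<omega>)\<^sup>2 \<le> (W l \<omega>)\<^sup>2 + (W (Suc l) \<omega>)\<^sup>2" for \<omega>
    unfolding Z_def descent_step_def W_def by simp
  show i: "integrable M (\<lambda>\<omega>. (Z \<omega>)\<^sup>2)"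
  proof (rule Bochner_Integration.integrable_bound)
    show "integrable M (\<lambda>\<omega>. (W l \<omega>)\<^sup>2 + (W (Suc l) \<omega>)\<^sup>2)"
      using W2 by (intro Bochner_Integration.integrable_add)
    show "AE \<omega> in M. norm ((Z \<omega>)\<^sup>2) \<le> norm ((W l \<omega>)\<^sup>2 + (W (Suc l) \<omega>)\<^sup>2)"
      using bound by (intro AE_I2) simp
  qed simp
  have "expectation (\<lambda>\<omega>. (Z \<omega>)\<^sup>2) \<le> expectation (\<lambda>\<omega>. (W l \<omega>)\<^sup>2 + (W (Suc l) \<omega>)\<^sup>2)"
    using i W2 bound by (intro integral_mono) auto
  also have "\<dots> \<le> 2 * (t - s)" using W2[of l] W2[of "Suc l"] by simp
  finally show "expectation (\<lambda>\<omega>. (Z \<omega>)\<^sup>2) \<le> 2 * (t - s)" .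
qed

end

section \<open>Almost sure growth of the noise\<close>

lemma summable_inverse_Suc_squares: "summable (\<lambda>j. C / (real (Suc j))\<^sup>2)"
proof -
  have "summable (\<lambda>j. inverse (real (Suc j) ^ 2))"
    using inverse_power_summable[of 2, where ?'a = real] by (subst summable_Suc_iff) auto
  then have "summable (\<lambda>j. C * inverse (real (Suc j) ^ 2))" by (rule summable_mult)
  then show ?thesis by (simp add: field_simps)
qed

context cbp_setting
begin

text \<open>
  The increments of \<open>B\<^sub>j\<close> over the \<open>2\<^sup>n\<close> dyadic intervals of length \<open>T / 2\<^sup>n\<close> have fourth powers with
  total expectation \<open>3 T\<^sup>2 / 2\<^sup>n\<close>. Divided by \<open>j\<^sup>2 r\<^sup>4\<^sup>n\<close> with \<open>1/2 < r\<^sup>4 < 1\<close> they remain summable over \<open>j\<close> and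
  \<open>n\<close>, so almost surely all increments at once are at most \<open>K \<surd>j r\<^sup>n\<close>, which is what chaining needs.
\<close>

lemma brownian_sup_growth:
  assumes T: "0 < T"
  shows "AE \<omega> in M. \<exists>K\<ge>0. \<forall>j\<ge>1. \<forall>s\<in>{0..T}. \<bar>B j s \<omega> - B j 0 \<omega>\<bar> \<le> K * sqrt (real j)"
proof -
  define r where "r = (9 / 10 :: real)"
  define \<rho> where "\<rho> = 1 / (2 * r ^ 4)"
  have r: "0 < r" "r < 1" "0 < \<rho>" "\<rho> < 1" unfolding r_def \<rho>_def by (simp_all add: power_divide)
  define D where "D j n i = increment (real i * T / 2 ^ n) (real (Suc i) * T / 2 ^ n) (Suc j)" for j n i :: nat
  define w where "w j n = (real (Suc j))\<^sup>2 * r ^ (4 * n)" for j n :: nat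
  have w: "0 < w j n" for j n using r unfolding w_def by simp
  \<comment> \<open>\<open>r\<close> has to satisfy \<open>r < 1\<close> for the chaining series and \<open>\<rho> = 1 / (2 r\<^sup>4) < 1\<close> for the moments.\<close>
  define q where "q j n \<omega> = (\<Sum>i<2 ^ n. (D j n i \<omega>) ^ 4 / w j n)" for j n \<omega>
  have q_nonneg: "0 \<le> q j n \<omega>" for j n \<omega>
    unfolding q_def using w by (intro sum_nonneg divide_nonneg_pos) auto
  have q: "has_bochner_integral M (q j n) (3 * T\<^sup>2 / (real (Suc j))\<^sup>2 * \<rho> ^ n)" for j n
  proof -
    have "has_bochner_integral M (\<lambda>\<omega>. (D j n i \<omega>) ^ 4 / w j n) (3 * (T / 2 ^ n)\<^sup>2 / w j n)" for i
    proof -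
      have "real i * T / 2 ^ n < real (Suc i) * T / 2 ^ n"
        using T by (intro divide_strict_right_mono) (auto simp: algebra_simps)
      moreover have "real (Suc i) * T / 2 ^ n - real i * T / 2 ^ n = T / 2 ^ n"
        by (simp add: field_simps)
      ultimately have "has_bochner_integral M (\<lambda>\<omega>. (D j n i \<omega>) ^ 4) (3 * (T / 2 ^ n)\<^sup>2)"
        using increment_moments(4)[of "Suc j" "real i * T / 2 ^ n" "real (Suc i) * T / 2 ^ n"] T
        unfolding D_def by simp
      then show ?thesis by (intro has_bochner_integral_divide_zero)
    qed
    then have "has_bochner_integral M (q j n) (\<Sum>i<(2::nat) ^ n. 3 * (T / 2 ^ n)\<^sup>2 / w j n)"
      unfolding q_def[abs_def] by (intro has_bochner_integral_sum) auto
    moreover have "(\<Sum>i<(2::nat) ^ n. 3 * (T / 2 ^ n)\<^sup>2 / w j n) = 3 * T\<^sup>2 / (real (Suc j))\<^sup>2 * \<rho> ^ n"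
      unfolding w_def \<rho>_def using r
      by (simp add: power_divide power_mult_distrib power_mult[symmetric] power2_eq_square field_simps
          del: of_nat_Suc)
    ultimately show ?thesis by simp
  qed
  have [measurable]: "q j n \<in> borel_measurable M" for j n using q by (auto simp: has_bochner_integral_iff)
  define S where "S \<omega> = (\<Sum>j n. ennreal (q j n \<omega>))" for \<omega>
  have "(\<integral>\<^sup>+\<omega>. S \<omega> \<partial>M) = (\<Sum>j n. \<integral>\<^sup>+\<omega>. ennreal (q j n \<omega>) \<partial>M)"
    unfolding S_def by (simp add: nn_integral_suminf)
  also have "\<dots> = (\<Sum>j n. ennreal (3 * T\<^sup>2 / (real (Suc j))\<^sup>2 * \<rho> ^ n))"
    using q q_nonneg by (intro suminf_cong) (simp add: nn_integral_eq_integral has_bochner_integral_iff)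
  also have "\<dots> = (\<Sum>j. ennreal (3 * T\<^sup>2 / (1 - \<rho>) / (real (Suc j))\<^sup>2))"
  proof (intro suminf_cong)
    fix j :: nat
    have "(\<lambda>n. 3 * T\<^sup>2 / (real (Suc j))\<^sup>2 * \<rho> ^ n) sums (3 * T\<^sup>2 / (real (Suc j))\<^sup>2 * (1 / (1 - \<rho>)))"
      using r by (intro sums_mult geometric_sums) auto
    then have "(\<Sum>n. ennreal (3 * T\<^sup>2 / (real (Suc j))\<^sup>2 * \<rho> ^ n)) = ennreal (3 * T\<^sup>2 / (real (Suc j))\<^sup>2 * (1 / (1 - \<rho>)))"
      using r by (intro suminf_ennreal_eq) auto
    then show "(\<Sum>n. ennreal (3 * T\<^sup>2 / (real (Suc j))\<^sup>2 * \<rho> ^ n)) = ennreal (3 * T\<^sup>2 / (1 - \<rho>) / (real (Suc j))\<^sup>2)"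
      by (simp add: field_simps)
  qed
  also have "\<dots> = ennreal (\<Sum>j. 3 * T\<^sup>2 / (1 - \<rho>) / (real (Suc j))\<^sup>2)"
    using r by (intro suminf_ennreal2 summable_inverse_Suc_squares) auto
  finally have "(\<integral>\<^sup>+\<omega>. S \<omega> \<partial>M) \<noteq> \<infinity>" by simp
  then have "AE \<omega> in M. S \<omega> \<noteq> \<infinity>"
    by (intro nn_integral_noteq_infinite) (auto simp: S_def)
  moreover have "AE \<omega> in M. \<forall>j. continuous_on {0..} (\<lambda>t. B (Suc j) t \<omega>)"
    unfolding AE_all_countable using brownian unfolding standard_brownian_motion_def by auto
  ultimately show ?thesis
  proof eventually_elim
    case (elim \<omega>)
    obtain R where R: "0 \<le> R" "S \<omega> = ennreal R" using elim(1) by (cases "S \<omega>") auto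
    \<comment> \<open>Adding \<open>1\<close> gives \<open>R \<le> K\<^sup>4\<close> without taking roots.\<close>
    define K where "K = R + 1"
    have K: "1 \<le> K" "R \<le> K ^ 4"
      using R self_le_power[of K 4] unfolding K_def by auto
    have incr: "\<bar>D j n i \<omega>\<bar> \<le> K * sqrt (real (Suc j)) * r ^ n" if "i < 2 ^ n" for j n i
    proof -
      have "(D j n i \<omega>) ^ 4 / w j n \<le> q j n \<omega>"
        unfolding q_def using that w[of j n] by (intro member_le_sum) auto
      moreover have "ennreal (q j n \<omega>) \<le> S \<omega>"
      proof -
        have "ennreal (q j n \<omega>) \<le> (\<Sum>n. ennreal (q j n \<omega>))"
          using sum_le_suminf[of "\<lambda>n. ennreal (q j n \<omega>)" "{n}"] by simp
        also have "\<dots> \<le> S \<omega>"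
          unfolding S_def using sum_le_suminf[of "\<lambda>j. \<Sum>n. ennreal (q j n \<omega>)" "{j}"] by simp
        finally show ?thesis .
      qed
      then have "q j n \<omega> \<le> R" using R by (simp add: ennreal_le_iff)
      ultimately have "(D j n i \<omega>) ^ 4 / w j n \<le> K ^ 4" using K(2) by linarith
      then have "(D j n i \<omega>) ^ 4 \<le> K ^ 4 * w j n" using w[of j n] by (simp add: field_simps)
      also have "\<dots> = (K * sqrt (real (Suc j)) * r ^ n) ^ 4"
      proof -
        have "sqrt (real (Suc j)) ^ 4 = (real (Suc j))\<^sup>2"
          using power_mult[of "sqrt (real (Suc j))" 2 2] by simp
        then show ?thesis
          unfolding w_def power_mult_distrib power_mult[of r n 4, symmetric]
          by (simp only: mult.assoc mult.commute[of n 4])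
      qed
      finally have "\<bar>D j n i \<omega>\<bar> ^ 4 \<le> (K * sqrt (real (Suc j)) * r ^ n) ^ 4" by simp
      moreover have "0 \<le> K * sqrt (real (Suc j)) * r ^ n" using K r by simp
      ultimately show ?thesis
        by (metis power_mono_iff abs_ge_zero zero_less_numeral)
    qed
    have "\<bar>B (Suc j) s \<omega> - B (Suc j) 0 \<omega>\<bar> \<le> K / (1 - r) * sqrt (real (Suc j))"
      if s: "s \<in> {0..T}" for j s
    proof -
      have "continuous_on {0..T} (\<lambda>t. B (Suc j) t \<omega>)"
        by (rule continuous_on_subset[of "{0..}"]) (use elim(2) in auto)
      from dyadic_chaining[OF this T less_imp_le[OF r(1)] r(2) incr[unfolded D_def increment_def] s]
      show ?thesis by simp
    qed
    then have "\<forall>j\<ge>1. \<forall>s\<in>{0..T}. \<bar>B j s \<omega> - B j 0 \<omega>\<bar> \<le> K / (1 - r) * sqrt (real j)"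
      by (metis Suc_le_D One_nat_def)
    then show ?case using K r by (intro exI[of _ "K / (1 - r)"]) auto
  qed
qed

text \<open>
  There are \<open>(m + 1)\<^sup>2\<close> steps of duration \<open>\<tau> / (m + 1)\<^sup>2\<close>, so their means add up to a multiple of
  \<open>(m + 1) \<surd>\<tau>\<close> whereas the variance of the sum is at most \<open>2 \<tau>\<close> for each \<open>m\<close>. Restricting to square
  numbers of steps makes the variances summable after division by \<open>(m + 1)\<^sup>2\<close>.
\<close>

lemma descent_sum_asymptotics:
  assumes a: "0 \<le> a" "a \<le> 1" and T: "0 \<le> T" and \<tau>: "0 < \<tau>"
  defines "u m i \<equiv> T + real i * (\<tau> / (real (Suc m))\<^sup>2)"
  shows "AE \<omega> in M. (\<lambda>m. (\<Sum>i<(Suc m)\<^sup>2. descent_step a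
      (\<lambda>j. B j (u m (Suc i)) \<omega> - B j (u m i) \<omega>) ((Suc m)\<^sup>2 - i)) / real (Suc m))
    \<longlonglongrightarrow> - (a * sqrt (2 / pi) / 2) * sqrt \<tau>"
proof -
  define c where "c = a * sqrt (2 / pi) / 2"
  define Z where "Z m i \<omega> = descent_step a (\<lambda>j. increment (u m i) (u m (Suc i)) j \<omega>) ((Suc m)\<^sup>2 - i)" for m i \<omega>
  define \<delta> where "\<delta> m = \<tau> / (real (Suc m))\<^sup>2" for m :: nat
  have \<delta>: "0 < \<delta> m" "u m (Suc i) - u m i = \<delta> m" "u m i < u m (Suc i)" "0 \<le> u m i" for m i
  proof -
    show "0 < \<delta> m" "0 \<le> u m i" unfolding \<delta>_def u_def using \<tau> T by auto
    show step: "u m (Suc i) - u m i = \<delta> m" unfolding \<delta>_def u_def by (simp add: add_divide_distrib ring_distribs)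
    show "u m i < u m (Suc i)" using step \<open>0 < \<delta> m\<close> by simp
  qed
  have u_mono: "u m i \<le> u m i'" if "i \<le> i'" for m i i'
    unfolding u_def using that \<tau> by (intro add_left_mono mult_right_mono) auto
  have Z: "has_bochner_integral M (Z m i) (- c * sqrt (\<delta> m))" "integrable M (\<lambda>\<omega>. (Z m i \<omega>)\<^sup>2)"
    "expectation (\<lambda>\<omega>. (Z m i \<omega>)\<^sup>2) \<le> 2 * \<delta> m" if "i < (Suc m)\<^sup>2" for m i
  proof -
    have "1 \<le> (Suc m)\<^sup>2 - i" using that by simp
    from descent_step_moments[OF a \<delta>(4) \<delta>(3) this]
    show "has_bochner_integral M (Z m i) (- c * sqrt (\<delta> m))" "integrable M (\<lambda>\<omega>. (Z m i \<omega>)\<^sup>2)"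
      "expectation (\<lambda>\<omega>. (Z m i \<omega>)\<^sup>2) \<le> 2 * \<delta> m"
      unfolding Z_def[abs_def] c_def \<delta>(2) by auto
  qed
  define V where "V m \<omega> = (\<Sum>i<(Suc m)\<^sup>2. Z m i \<omega> - expectation (Z m i))" for m \<omega>
  have V: "integrable M (\<lambda>\<omega>. (V m \<omega>)\<^sup>2)" "expectation (\<lambda>\<omega>. (V m \<omega>)\<^sup>2) \<le> 2 * \<tau>" for m
  proof -
    have indep: "indep_var borel (Z m i) borel (Z m i')" if "i < i'" for i i'
      unfolding Z_def[abs_def] using \<delta>(3,4) u_mono that
      by (intro descent_step_indep) (auto simp: less_imp_le)
    note var = variance_indep_sum_le[of "(Suc m)\<^sup>2" "Z m" "2 * \<delta> m"]
    show "integrable M (\<lambda>\<omega>. (V m \<omega>)\<^sup>2)"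
      unfolding V_def using Z indep by (intro var) (auto simp: has_bochner_integral_iff)
    have "expectation (\<lambda>\<omega>. (V m \<omega>)\<^sup>2) \<le> real ((Suc m)\<^sup>2) * (2 * \<delta> m)"
      unfolding V_def using Z indep by (intro var) (auto simp: has_bochner_integral_iff)
    then show "expectation (\<lambda>\<omega>. (V m \<omega>)\<^sup>2) \<le> 2 * \<tau>"
      unfolding \<delta>_def by (simp add: field_simps del: of_nat_Suc)
  qed
  have mean: "(\<Sum>i<(Suc m)\<^sup>2. Z m i \<omega>) / real (Suc m) = V m \<omega> / real (Suc m) - c * sqrt \<tau>" for m \<omega>
  proof -
    have "V m \<omega> = (\<Sum>i<(Suc m)\<^sup>2. Z m i \<omega> + c * sqrt (\<delta> m))"
      unfolding V_def using Z(1) by (intro sum.cong) (auto simp: has_bochner_integral_iff)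
    also have "\<dots> = (\<Sum>i<(Suc m)\<^sup>2. Z m i \<omega>) + (real (Suc m))\<^sup>2 * (c * sqrt (\<delta> m))"
      by (simp add: sum.distrib)
    also have "sqrt (\<delta> m) = sqrt \<tau> / real (Suc m)"
      unfolding \<delta>_def by (simp add: real_sqrt_divide)
    finally show ?thesis by (simp add: field_simps power2_eq_square del: of_nat_Suc)
  qed
  have "AE \<omega> in M. (\<lambda>m. (V m \<omega>)\<^sup>2 / (real (Suc m))\<^sup>2) \<longlonglongrightarrow> 0"
  proof (rule AE_tendsto_0_of_summable_expectation)
    show "summable (\<lambda>m. 2 * \<tau> / (real (Suc m))\<^sup>2)" by (rule summable_inverse_Suc_squares)
    show "expectation (\<lambda>\<omega>. (V m \<omega>)\<^sup>2 / (real (Suc m))\<^sup>2) \<le> 2 * \<tau> / (real (Suc m))\<^sup>2" for m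
      using V(2)[of m] by (simp add: divide_right_mono)
  qed (use V in auto)
  then show ?thesis
  proof eventually_elim
    case (elim \<omega>)
    have "(\<lambda>m. sqrt ((V m \<omega>)\<^sup>2 / (real (Suc m))\<^sup>2)) \<longlonglongrightarrow> sqrt 0"
      using elim by (rule tendsto_real_sqrt)
    then have "(\<lambda>m. \<bar>V m \<omega> / real (Suc m)\<bar>) \<longlonglongrightarrow> 0"
      by (simp add: real_sqrt_divide)
    then have "(\<lambda>m. V m \<omega> / real (Suc m)) \<longlonglongrightarrow> 0" by (rule tendsto_rabs_zero_cancel)
    then have "(\<lambda>m. V m \<omega> / real (Suc m) - c * sqrt \<tau>) \<longlonglongrightarrow> 0 - c * sqrt \<tau>"
      by (intro tendsto_intros)
    then show ?case
      unfolding mean[symmetric] by (simp add: Z_def increment_def c_def)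
  qed
qed

end

section \<open>Lower bounds for the high particles\<close>

lemma cbp_paths_mono_index:
  assumes "cbp_paths p g \<xi> b X L" "0 \<le> t" "1 \<le> i" "i \<le> j"
  shows "X i t \<le> X j t"
  using assms(4)
proof (induction j rule: dec_induct)
  case (step n)
  have "X n t \<le> X (n + 1) t"
    using assms(1-3) step unfolding cbp_paths_def by auto
  with step show ?case by simp
qed simp

text \<open>
  The constant \<open>C\<close> in the oscillation bound refers to \<open>[0, T]\<close> only, so the time horizon \<open>T + N\<close> can be
  chosen afterwards, with \<open>c \<surd>N\<close> exceeding \<open>2 C + \<bar>K\<bar>\<close>.
\<close>

lemma cbp_paths_superdiffusive_lower_bound:
  assumes paths: "cbp_paths p g \<xi> b X L" and p: "0 \<le> p" "p < 1 / 2" and a: "a = (1 - 2 * p) / (1 - p)"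
    and G: "\<And>j. 1 \<le> j \<Longrightarrow> \<bar>g j\<bar> \<le> G" and T: "0 < T"
    and osc: "0 \<le> C" "\<And>j s. \<lbrakk>1 \<le> j; s \<in> {0..T}\<rbrakk> \<Longrightarrow> \<bar>b j s - b j 0\<bar> \<le> C * sqrt (real j)"
    and c: "0 < c"
    and descent: "\<And>N :: nat. 1 \<le> N \<Longrightarrow> (\<lambda>m. (\<Sum>i<(Suc m)\<^sup>2. descent_step a
      (\<lambda>j. b j (T + real (Suc i) * (real N / (real (Suc m))\<^sup>2)) - b j (T + real i * (real N / (real (Suc m))\<^sup>2)))
      ((Suc m)\<^sup>2 - i)) / real (Suc m)) \<longlonglongrightarrow> - c * sqrt (real N)"
  shows "\<forall>\<^sub>F M in sequentially. \<forall>s\<in>{0..T}. K * sqrt (real M) \<le> X M s"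
proof -
  have a01: "0 \<le> a" "a \<le> 1" unfolding a using p by (auto simp: field_simps)
  have G0: "0 \<le> G" using G[of 1] by simp
  obtain N0 :: nat where N0: "((2 * C + \<bar>K\<bar> + 2) / c)\<^sup>2 < real N0"
    using reals_Archimedean2 by blast
  define N where "N = Suc N0"
  have N: "1 \<le> N" "2 * C + \<bar>K\<bar> + 2 \<le> c * sqrt (real N)"
  proof -
    have "((2 * C + \<bar>K\<bar> + 2) / c)\<^sup>2 \<le> real N" using N0 unfolding N_def by simp
    then have "(2 * C + \<bar>K\<bar> + 2) / c \<le> sqrt (real N)" by (rule real_le_rsqrt)
    then show "2 * C + \<bar>K\<bar> + 2 \<le> c * sqrt (real N)" using c by (simp add: field_simps)
  qed (simp add: N_def)
  define Z where "Z m = (\<Sum>i<(Suc m)\<^sup>2. descent_step a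
      (\<lambda>j. b j (T + real (Suc i) * (real N / (real (Suc m))\<^sup>2)) - b j (T + real i * (real N / (real (Suc m))\<^sup>2)))
      ((Suc m)\<^sup>2 - i))" for m
  \<comment> \<open>\<open>A\<close> collects the terms that do not grow with \<open>m\<close>; the spare \<open>1\<close> in the slope absorbs them.\<close>
  define A where "A = \<bar>X 1 (T + real N)\<bar> + G * (T + real N) + 2 * C + \<bar>K\<bar>"
  have "\<forall>\<^sub>F m in sequentially. Z m / real (Suc m) < - c * sqrt (real N) + 1"
    using descent[OF N(1), folded Z_def] by (rule order_tendstoD) simp
  then obtain m0 where m0: "\<And>m. m0 \<le> m \<Longrightarrow> Z m / real (Suc m) < - c * sqrt (real N) + 1"
    unfolding eventually_sequentially by blast
  have lower: "\<bar>K\<bar> * (real (Suc m) + 1) \<le> X (Suc ((Suc m)\<^sup>2)) s"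
    if m: "m0 \<le> m" "A \<le> real m" and s: "s \<in> {0..T}" for m s
  proof -
    let ?n = "(Suc m)\<^sup>2"
    define u where "u i = T + real i * (real N / (real (Suc m))\<^sup>2)" for i :: nat
    have u: "u 0 = T" "u ?n = T + real N" "\<And>i. u i \<le> u (Suc i)"
      unfolding u_def by (auto simp: field_simps)
    have "X 1 (u ?n) \<le> geom_avg a (\<lambda>j. X j (u 0)) (Suc ?n) + G * (u ?n - u 0) + Z m"
      unfolding Z_def u_def[symmetric] using u(3) T
      by (intro lowest_particle_le_descent[OF paths p a G]) (auto simp: u(1))
    then have 1: "X 1 (T + real N) \<le> geom_avg a (\<lambda>j. X j T) (Suc ?n) + G * real N + Z m"
      using u by simp
    have 2: "geom_avg a (\<lambda>j. X j T) (Suc ?n) \<le> geom_avg a (\<lambda>j. X j s) (Suc ?n) + G * (T - s)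
        + geom_avg a (\<lambda>j. b j T - b j s) (Suc ?n)"
      using s by (intro geom_avg_increment_le[OF paths p a G]) auto
    have "sqrt (real (Suc ?n)) \<le> real (Suc m) + 1"
      by (rule real_le_lsqrt) (auto simp: power2_eq_square algebra_simps)
    then have sq: "C * sqrt (real (Suc ?n)) \<le> C * (real (Suc m) + 1)"
      using osc(1) by (rule mult_left_mono)
    have "geom_avg a (\<lambda>j. b j T - b j s) (Suc ?n) \<le> geom_avg a (\<lambda>j. 2 * (C * (real (Suc m) + 1))) (Suc ?n)"
    proof (intro geom_avg_mono a01)
      fix j assume j: "1 \<le> j" "j \<le> Suc ?n"
      have "C * sqrt (real j) \<le> C * sqrt (real (Suc ?n))"
        using osc(1) of_nat_mono[OF j(2), where ?'a = real] by (intro mult_left_mono real_sqrt_le_mono)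
      then show "b j T - b j s \<le> 2 * (C * (real (Suc m) + 1))"
        using osc(2)[OF j(1), of T] osc(2)[OF j(1), of s] s T sq by auto
    qed simp
    then have 3: "geom_avg a (\<lambda>j. b j T - b j s) (Suc ?n) \<le> 2 * (C * (real (Suc m) + 1))"
      by (simp only: geom_avg_const)
    have 4: "geom_avg a (\<lambda>j. X j s) (Suc ?n) \<le> X (Suc ?n) s"
      using paths s by (intro geom_avg_le_top a01) (auto simp: cbp_paths_def)
    have 5: "Z m \<le> (- c * sqrt (real N) + 1) * real (Suc m)"
      using m0[OF m(1)] by (simp add: field_simps del: of_nat_Suc)
    have 6: "(2 * C + \<bar>K\<bar> + 2) * real (Suc m) \<le> c * sqrt (real N) * real (Suc m)"
      using N(2) by (rule mult_right_mono) simp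
    have 7: "G * (T - s) \<le> G * T" using s G0 by (intro mult_left_mono) auto
    have "X 1 (T + real N) - G * (T + real N) - 2 * C + (\<bar>K\<bar> + 1) * real (Suc m) \<le> X (Suc ?n) s"
    proof -
      define R CR KR Q GT GN where "R = real (Suc m)" and "CR = C * R" and "KR = \<bar>K\<bar> * R"
        and "Q = c * sqrt (real N) * R" and "GT = G * T" and "GN = G * real N"
      note defs = this
      have "geom_avg a (\<lambda>j. b j T - b j s) (Suc ?n) \<le> 2 * CR + 2 * C" "Z m \<le> R - Q" "2 * CR + KR + 2 * R \<le> Q"
        using 3 5 6 unfolding defs by (simp_all only: ring_distribs mult_1 mult.assoc mult_minus_left)
      with 1 2 4 7 have "X 1 (T + real N) - (GT + GN) - 2 * C + (KR + R) \<le> X (Suc ?n) s"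
        unfolding defs(5,6)[symmetric] by linarith
      then show ?thesis unfolding defs by (simp only: ring_distribs mult_1)
    qed
    then show ?thesis using m(2) unfolding A_def by (simp add: algebra_simps)
  qed
  define m1 where "m1 = max m0 (nat \<lceil>A\<rceil>)"
  have "K * sqrt (real M) \<le> X M s" if M: "(Suc m1)\<^sup>2 < M" and s: "s \<in> {0..T}" for M s
  proof -
    \<comment> \<open>Locate \<open>M\<close> between the squares of \<open>k\<close> and \<open>k + 1\<close>.\<close>
    define k' where "k' = (LEAST k. M \<le> k\<^sup>2)"
    have k': "M \<le> k'\<^sup>2" unfolding k'_def by (rule LeastI[of _ M]) (simp add: power2_eq_square)
    have "Suc m1 < k'"
    proof (rule ccontr)
      assume "\<not> Suc m1 < k'"
      then have "k'\<^sup>2 \<le> (Suc m1)\<^sup>2" by (intro power_mono) simp_all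
      then show False using k' M by linarith
    qed
    then obtain k m where k: "k' = Suc k" "k = Suc m" "m1 \<le> m"
      by (metis Suc_le_D Suc_less_eq less_Suc_eq_le less_imp_Suc_add)
    have "\<not> M \<le> k\<^sup>2"
      using not_less_Least[of k "\<lambda>k. M \<le> k\<^sup>2"] unfolding k'_def[symmetric] k(1) by simp
    then have kM: "Suc (k\<^sup>2) \<le> M" by simp
    have "real M \<le> (real k + 1)\<^sup>2"
      using of_nat_mono[OF k', where ?'a = real] unfolding k(1) by (simp add: add.commute)
    then have "sqrt (real M) \<le> real k + 1" by (intro real_le_lsqrt) auto
    then have "\<bar>K\<bar> * sqrt (real M) \<le> \<bar>K\<bar> * (real k + 1)" by (intro mult_left_mono) auto
    also have "\<dots> \<le> X (Suc (k\<^sup>2)) s"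
      unfolding k(2) using k(3) s by (intro lower) (auto simp: m1_def)
    also have "\<dots> \<le> X M s" using s kM by (intro cbp_paths_mono_index[OF paths]) auto
    finally show ?thesis by (smt (verit) mult_right_mono real_sqrt_ge_zero of_nat_0_le_iff)
  qed
  then show ?thesis unfolding eventually_sequentially by (intro exI[of _ "Suc ((Suc m1)\<^sup>2)"]) auto
qed

lemma liminf_eq_infinityI:
  fixes f :: "nat \<Rightarrow> real"
  assumes "\<And>K. \<forall>\<^sub>F M in sequentially. K * sqrt (real M) \<le> f M"
  shows "liminf (\<lambda>M. ereal (f M / sqrt (real M))) = \<infinity>"
proof (rule lim_imp_Liminf)
  show "(\<lambda>M. ereal (f M / sqrt (real M))) \<longlonglongrightarrow> \<infinity>"
    unfolding tendsto_PInfty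
  proof
    fix K :: real
    show "\<forall>\<^sub>F M in sequentially. ereal K < ereal (f M / sqrt (real M))"
      using assms[of "K + 1"] eventually_gt_at_top[of 0]
    proof eventually_elim
      case (elim M)
      then have "K + 1 \<le> f M / sqrt (real M)" by (simp add: pos_le_divide_eq)
      then show ?case by simp
    qed
  qed
qed simp

text \<open>
  The horizons \<open>T + N\<close> range over a countable set, so one null set serves all of them. The second
  and third conclusions transfer the bound to later particles and to the initial positions.
\<close>

lemma (in cbp_setting) superdiffusive_lower_bound:
  assumes p: "0 \<le> p" "p < 1 / 2" and g: "bdd_above ((\<lambda>j. \<bar>g j\<bar>) ` {1..})"
    and sol: "infinite_cbp M F p g x B X" and T: "0 < T"
  shows "AE \<omega> in M. (\<forall>K. \<forall>\<^sub>F n in sequentially. \<forall>s\<in>{0..T}. K * sqrt (real n) \<le> X n s \<omega>)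
    \<and> (\<forall>s\<ge>0. \<forall>i\<ge>1. \<forall>j\<ge>i. X i s \<omega> \<le> X j s \<omega>) \<and> (\<forall>j\<ge>1. X j 0 \<omega> = x j \<omega>)"
proof -
  define a where "a = (1 - 2 * p) / (1 - p)"
  have a: "0 < a" "a \<le> 1" unfolding a_def using p by (auto simp: field_simps)
  define c where "c = a * sqrt (2 / pi) / 2"
  have c: "0 < c" using a unfolding c_def by simp
  obtain G where G: "\<And>j. 1 \<le> j \<Longrightarrow> \<bar>g j\<bar> \<le> G"
    using g unfolding bdd_above_def by auto
  obtain L where paths: "AE \<omega> in M. cbp_paths p g (\<lambda>j. x j \<omega>) (\<lambda>j t. B j t \<omega>) (\<lambda>j t. X j t \<omega>) (\<lambda>j t. L j t \<omega>)"
    using sol unfolding infinite_cbp_def by auto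
  have start: "AE \<omega> in M. \<forall>j. B (Suc j) 0 \<omega> = 0"
    unfolding AE_all_countable using brownian unfolding standard_brownian_motion_def by auto
  have descent: "AE \<omega> in M. \<forall>N. (\<lambda>m. (\<Sum>i<(Suc m)\<^sup>2. descent_step a
      (\<lambda>j. B j (T + real (Suc i) * (real (Suc N) / (real (Suc m))\<^sup>2)) \<omega>
         - B j (T + real i * (real (Suc N) / (real (Suc m))\<^sup>2)) \<omega>)
      ((Suc m)\<^sup>2 - i)) / real (Suc m)) \<longlonglongrightarrow> - c * sqrt (real (Suc N))"
    unfolding AE_all_countable c_def using a T by (intro allI descent_sum_asymptotics) auto
  from paths start descent brownian_sup_growth[OF T] show ?thesis
  proof eventually_elim
    case (elim \<omega>)
    from elim(4) obtain C where C: "0 \<le> C"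
      "\<And>j s. \<lbrakk>1 \<le> j; s \<in> {0..T}\<rbrakk> \<Longrightarrow> \<bar>B j s \<omega> - B j 0 \<omega>\<bar> \<le> C * sqrt (real j)" by blast
    have "\<forall>\<^sub>F n in sequentially. \<forall>s\<in>{0..T}. K * sqrt (real n) \<le> X n s \<omega>" for K
    proof (rule cbp_paths_superdiffusive_lower_bound[OF elim(1) p a_def G T C c])
      fix N :: nat assume "1 \<le> N"
      then obtain N' where "N = Suc N'" by (cases N) auto
      then show "(\<lambda>m. (\<Sum>i<(Suc m)\<^sup>2. descent_step a
          (\<lambda>j. B j (T + real (Suc i) * (real N / (real (Suc m))\<^sup>2)) \<omega>
             - B j (T + real i * (real N / (real (Suc m))\<^sup>2)) \<omega>)
          ((Suc m)\<^sup>2 - i)) / real (Suc m)) \<longlonglongrightarrow> - c * sqrt (real N)"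
        using elim(3) by blast
    qed
    moreover have "X i s \<omega> \<le> X j s \<omega>" if "0 \<le> s" "1 \<le> i" "i \<le> j" for i j s
      by (rule cbp_paths_mono_index[OF elim(1) that])
    moreover have "X j 0 \<omega> = x j \<omega>" if j: "1 \<le> j" for j
    proof -
      have "X j 0 \<omega> = x j \<omega> + g j * 0 + B j 0 \<omega> + p * L (j - 1) 0 \<omega> - (1 - p) * L j 0 \<omega>"
        using elim(1) j unfolding cbp_paths_def by blast
      moreover have "L i 0 \<omega> = 0" for i
        using elim(1) unfolding cbp_paths_def by (cases i) auto
      moreover have "B j 0 \<omega> = 0" using elim(2) j by (cases j) auto
      ultimately show ?thesis by simp
    qed
    ultimately show ?case by blast
  qed
qed

theorem lemma6p2:
  fixes P :: "'a measure"
    and F :: "real \<Rightarrow> 'a measure"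
    and B X :: "nat \<Rightarrow> real \<Rightarrow> 'a \<Rightarrow> real"
    and x :: "nat \<Rightarrow> 'a \<Rightarrow> real"
    and p :: real
    and g :: "nat \<Rightarrow> real"
  assumes "cbp_setting P F B x"
    and "0 \<le> p" and "p < 1 / 2"
    and "bdd_above ((\<lambda>j. \<bar>g j\<bar>) ` {1..})"
    and "infinite_cbp P F p g x B X"
  shows "(\<forall>i\<ge>1. \<forall>T>0. AE \<omega> in P.
            liminf (\<lambda>M. ereal (I_star X M i T \<omega> / sqrt (real M))) = \<infinity>) \<and>
         (AE \<omega> in P. liminf (\<lambda>M. ereal (x M \<omega> / sqrt (real M))) = \<infinity>)"
proof -
  interpret cbp_setting P F B x by fact
  note bound = superdiffusive_lower_bound[OF assms(2-5)]
  have "AE \<omega> in P. liminf (\<lambda>M. ereal (I_star X M i T \<omega> / sqrt (real M))) = \<infinity>"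
    if "1 \<le> i" "0 < T" for i T
    using bound[OF \<open>0 < T\<close>]
  proof eventually_elim
    case (elim \<omega>)
    show ?case
    proof (rule liminf_eq_infinityI)
      fix K :: real
      have "\<forall>\<^sub>F n in sequentially. \<forall>s\<in>{0..T}. K * sqrt (real n) \<le> X n s \<omega>" using elim by blast
      then show "\<forall>\<^sub>F n in sequentially. K * sqrt (real n) \<le> I_star X n i T \<omega>"
        using eventually_ge_at_top[of 1]
      proof eventually_elim
        case (elim n)
        show ?case unfolding I_star_def
        proof (rule cINF_greatest)
          fix s assume s: "s \<in> {0..T}"
          then have "X n s \<omega> \<le> X (i + n) s \<omega>"
            using \<open>1 \<le> n\<close> \<open>_ \<and> (\<forall>s\<ge>0. _ s) \<and> _\<close> by auto
          then show "K * sqrt (real n) \<le> X (i + n) s \<omega>" using elim(1) s by fastforce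
        qed (use \<open>0 < T\<close> in auto)
      qed
    qed
  qed
  moreover have "AE \<omega> in P. liminf (\<lambda>M. ereal (x M \<omega> / sqrt (real M))) = \<infinity>"
    using bound[OF zero_less_one]
  proof eventually_elim
    case (elim \<omega>)
    show ?case
    proof (rule liminf_eq_infinityI)
      fix K :: real
      have "\<forall>\<^sub>F n in sequentially. \<forall>s\<in>{0..1}. K * sqrt (real n) \<le> X n s \<omega>" using elim by blast
      then show "\<forall>\<^sub>F n in sequentially. K * sqrt (real n) \<le> x n \<omega>"
        using eventually_ge_at_top[of 1]
      proof eventually_elim
        case (elim n)
        then have "K * sqrt (real n) \<le> X n 0 \<omega>" by simp
        then show ?case using \<open>1 \<le> n\<close> \<open>_ \<and> _ \<and> (\<forall>j\<ge>1. X j 0 \<omega> = x j \<omega>)\<close> by simp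
      qed
    qed
  qed
  ultimately show ?thesis by blast
qed

end
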